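(* Consider the third-order model of $N$ coupled synchronous machines, with shunt susceptances satisfying $\Gamma_i\le 0$ for all $i\in\{1,\dots,N\}$ (the physical parameter regime consistent with Kirchhoff's nodal law). Then at every equilibrium $(\boldsymbol{\Theta}^*,\boldsymbol{0},\boldsymbol{E}^* )$ of the model the voltage subsystem is linearly asymptotically stable: all eigenvalues of the voltage submatrix $C$ have negative real part. Moreover these real parts are bounded away from zero: there is a constant $\delta>0$, independent of $N$, of the model parameters (with all $\Gamma_i\le 0$) and of the equilibrium, such that $\operatorname{Re}\lambda\le-\delta$ for every eigenvalue $\lambda$ of $C$.
   Context: The third-order model for $N$ machines has state variables $\Theta_i(t)\in\mathbb{R}$, $\omega_i(t)\in\mathbb{R}$, $E_i(t)\ge 0$ ($i=1,\dots,N$) obeying $$\dot\Theta_i=\omega_i,\qquad \dot\omega_i=P_i-\alpha_i\omega_i+\sum_{j=1}^N B_{ij}E_iE_j\sin(\Theta_j-\Theta_i),$$ $$\dot E_i=E^f_i+(X_i\Gamma_i-1)E_i+X_i\sum_{j\ne i}B_{ij}\bigl(E_j\cos(\Theta_j-\Theta_i)-E_i\bigr).$$ Parameters: $P_i\in\mathbb{R}$, damping $\alpha_i>0$, voltage set point $E^f_i>0$, reactance $X_i\ge 0$, and a real symmetric susceptance matrix $B=(B_{ij})$ with $B_{ij}\ge 0$ for $i\neq j$ and diagonal entries $B_{ii}=\Gamma_i-\sum_{j\ne i}B_{ij}<0$, where $\Gamma_i\in\mathbb{R}$ is called the shunt susceptance of node $i$. An equilibrium is a state at which $\dot\Theta_i=\dot\omega_i=\dot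 E_i=0$ for all $i$. The voltage submatrix $C\in\mathbb{R}^{N\times N}$ at an equilibrium is the block $\partial\dot E_i/\partial E_j$ of the Jacobian: $$C_{ij}=X_iB_{ij}\cos(\Theta_j^*-\Theta_i^* )\ \ (i\ne j),\qquad C_{ii}=X_i\Gamma_i-1-X_i\sum_{k\ne i}B_{ik}.$$ *)

theory Defs
  imports Complex_Main "Jordan_Normal_Form.Char_Poly"
begin

text \<open>
  The nodes of an \<open>N\<close>-machine system are \<open>0, \<dots>, N - 1\<close>. The number \<open>N\<close> is an ordinary argument
  rather than a type parameter, so that a constant can be quantified before it. Values of the
  functions below at indices outside this range are irrelevant.
\<close>

record machine_params =
  power :: "nat \<Rightarrow> real"               \<comment> \<open>\<open>P\<^sub>i\<close>\<close>
  damping :: "nat \<Rightarrow> real"             \<comment> \<open>\<open>\<alpha>\<^sub>i\<close>\<close>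
  set_voltage :: "nat \<Rightarrow> real"         \<comment> \<open>\<open>E\<^sup>f\<^sub>i\<close>\<close>
  reactance :: "nat \<Rightarrow> real"           \<comment> \<open>\<open>X\<^sub>i\<close>\<close>
  shunt :: "nat \<Rightarrow> real"               \<comment> \<open>\<open>\<Gamma>\<^sub>i\<close>\<close>
  suscept :: "nat \<Rightarrow> nat \<Rightarrow> real"      \<comment> \<open>\<open>B\<^sub>i\<^sub>j\<close>\<close>

record machine_state =
  angle :: "nat \<Rightarrow> real"               \<comment> \<open>\<open>\<Theta>\<^sub>i\<close>\<close>
  freq :: "nat \<Rightarrow> real"                \<comment> \<open>\<open>\<omega>\<^sub>i\<close>\<close>
  voltage :: "nat \<Rightarrow> real"             \<comment> \<open>\<open>E\<^sub>i\<close>\<close>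

definition third_order_params :: "nat \<Rightarrow> machine_params \<Rightarrow> bool" where
  "third_order_params N p \<longleftrightarrow>
     (\<forall>i<N. damping p i > 0 \<and> set_voltage p i > 0 \<and> reactance p i \<ge> 0) \<and>
     (\<forall>i<N. \<forall>j<N. suscept p i j = suscept p j i) \<and>
     (\<forall>i<N. \<forall>j<N. i \<noteq> j \<longrightarrow> suscept p i j \<ge> 0) \<and>
     (\<forall>i<N. suscept p i i = shunt p i - (\<Sum>j\<in>{..<N} - {i}. suscept p i j)) \<and>
     (\<forall>i<N. suscept p i i < 0)"

text \<open>The right-hand sides of the equations of motion for \<open>\<Theta>\<^sub>i\<close>, \<open>\<omega>\<^sub>i\<close> and \<open>E\<^sub>i\<close>.\<close>

definition angle_rhs :: "machine_state \<Rightarrow> nat \<Rightarrow> real" where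
  "angle_rhs s i = freq s i"

definition freq_rhs :: "nat \<Rightarrow> machine_params \<Rightarrow> machine_state \<Rightarrow> nat \<Rightarrow> real" where
  "freq_rhs N p s i =
     power p i - damping p i * freq s i
     + (\<Sum>j<N. suscept p i j * voltage s i * voltage s j * sin (angle s j - angle s i))"

definition voltage_rhs :: "nat \<Rightarrow> machine_params \<Rightarrow> machine_state \<Rightarrow> nat \<Rightarrow> real" where
  "voltage_rhs N p s i =
     set_voltage p i + (reactance p i * shunt p i - 1) * voltage s i
     + reactance p i * (\<Sum>j\<in>{..<N} - {i}.
         suscept p i j * (voltage s j * cos (angle s j - angle s i) - voltage s i))"

definition equilibrium :: "nat \<Rightarrow> machine_params \<Rightarrow> machine_state \<Rightarrow> bool" where
  "equilibrium N p s \<longleftrightarrow>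
     (\<forall>i<N. voltage s i \<ge> 0) \<and>
     (\<forall>i<N. angle_rhs s i = 0 \<and> freq_rhs N p s i = 0 \<and> voltage_rhs N p s i = 0)"

definition voltage_submatrix :: "nat \<Rightarrow> machine_params \<Rightarrow> machine_state \<Rightarrow> real mat" where
  "voltage_submatrix N p s = mat N N (\<lambda>(i, j).
     if i = j
     then reactance p i * shunt p i - 1 - reactance p i * (\<Sum>k\<in>{..<N} - {i}. suscept p i k)
     else reactance p i * suscept p i j * cos (angle s j - angle s i))"

lemma equilibrium_freq: "equilibrium N p s \<Longrightarrow> i < N \<Longrightarrow> freq s i = 0"
  by (simp add: equilibrium_def angle_rhs_def)

text \<open>The matrix is the block of partial derivatives of the voltage equations in the voltages.\<close>

lemma voltage_submatrix_jacobian: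
  assumes "i < N" "j < N"
  shows "((\<lambda>e. voltage_rhs N p (s\<lparr>voltage := (voltage s)(j := e)\<rparr>) i)
           has_real_derivative voltage_submatrix N p s $$ (i, j)) (at (voltage s j))"
proof (cases "i = j")
  case True
  have eq: "(\<lambda>e. voltage_rhs N p (s\<lparr>voltage := (voltage s)(j := e)\<rparr>) i) =
    (\<lambda>e. set_voltage p i + (reactance p i * shunt p i - 1) * e
      + reactance p i * (\<Sum>k\<in>{..<N} - {i}.
          suscept p i k * (voltage s k * cos (angle s k - angle s i) - e)))"
    using True by (auto simp: voltage_rhs_def fun_eq_iff intro!: sum.cong)
  show ?thesis
    unfolding eq using True assms
    by (auto intro!: derivative_eq_intros simp: voltage_submatrix_def sum_negf)
next
  case False
  have eq: "(\<lambda>e. voltage_rhs N p (s\<lparr>voltage := (voltage s)(j := e)\<rparr>) i) =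
    (\<lambda>e. set_voltage p i + (reactance p i * shunt p i - 1) * voltage s i
      + reactance p i * (suscept p i j * (e * cos (angle s j - angle s i) - voltage s i)
          + (\<Sum>k\<in>{..<N} - {i} - {j}.
              suscept p i k * (voltage s k * cos (angle s k - angle s i) - voltage s i))))"
    using False assms
    by (auto simp: voltage_rhs_def fun_eq_iff sum.remove[of "{..<N} - {i}" j]
        intro!: sum.cong)
  show ?thesis
    unfolding eq using False assms
    by (auto intro!: derivative_eq_intros simp: voltage_submatrix_def)
qed

end

theory Submission
  imports Defs
begin

text \<open>
  By Gershgorin's theorem every eigenvalue \<open>z\<close> of \<open>C\<close> satisfies, for some row \<open>i\<close>,
  \<open>Re z \<le> C\<^sub>i\<^sub>i + \<Sum>\<^bsub>j \<noteq> i\<^esub> \<bar>C\<^sub>i\<^sub>j\<bar>\<close>. As \<open>\<bar>cos\<bar> \<le> 1\<close>, the couplings \<open>X\<^sub>i B\<^sub>i\<^sub>j\<close> in the radius are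
  cancelled by those in the diagonal entry, and what remains is \<open>X\<^sub>i \<Gamma>\<^sub>i - 1 \<le> -1\<close>.
\<close>

text \<open>Compare both sides of \<open>A *\<^sub>v v = z \<cdot>\<^sub>v v\<close> in a row
  \<open>i\<close> where the eigenvector entry has maximal norm \<open>m\<close>: moving the
  diagonal term to the left leaves a sum in which every entry of \<open>v\<close> is at most
  \<open>m\<close> in norm, and \<open>m\<close> cancels.\<close>

lemma gershgorin:
  fixes A :: "'a :: real_normed_field mat"
  assumes A: "A \<in> carrier_mat n n" and ev: "eigenvalue A z"
  shows "\<exists>i<n. norm (z - A $$ (i, i)) \<le> (\<Sum>j\<in>{..<n} - {i}. norm (A $$ (i, j)))"
proof -
  from ev obtain v where "eigenvector A v z"
    unfolding eigenvalue_def by blast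
  with A have v: "dim_vec v = n" "v \<noteq> 0\<^sub>v n" and Av: "A *\<^sub>v v = z \<cdot>\<^sub>v v"
    unfolding eigenvector_def by auto
  from v obtain k where k: "k < n" "v $ k \<noteq> 0"
    by (metis eq_vecI index_zero_vec)
  define m where "m = Max ((\<lambda>i. norm (v $ i)) ` {..<n})"
  have m_ge: "norm (v $ j) \<le> m" if "j < n" for j
    unfolding m_def using that by (intro Max_ge) auto
  have "m \<in> (\<lambda>i. norm (v $ i)) ` {..<n}"
    unfolding m_def using k by (intro Max_in) auto
  then obtain i where i: "i < n" "norm (v $ i) = m"
    by auto
  \<comment> \<open>An eigenvector has a nonzero entry, so the final division by \<open>m\<close> is
    legitimate.\<close>
  have m_pos: "m > 0"
    using m_ge[OF k(1)] k(2) by (meson less_le_trans zero_less_norm_iff)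
  have "z * v $ i = (A *\<^sub>v v) $ i"
    using Av i v by simp
  also have "\<dots> = (\<Sum>j<n. A $$ (i, j) * v $ j)"
    using A i v by (auto simp: scalar_prod_def lessThan_atLeast0 intro!: sum.cong)
  also have "\<dots> = A $$ (i, i) * v $ i + (\<Sum>j\<in>{..<n} - {i}. A $$ (i, j) * v $ j)"
    using i by (simp add: sum.remove)
  finally have "(z - A $$ (i, i)) * v $ i = (\<Sum>j\<in>{..<n} - {i}. A $$ (i, j) * v $ j)"
    by (simp add: algebra_simps)
  then have "norm (z - A $$ (i, i)) * m = norm (\<Sum>j\<in>{..<n} - {i}. A $$ (i, j) * v $ j)"
    by (metis i(2) norm_mult)
  also have "\<dots> \<le> (\<Sum>j\<in>{..<n} - {i}. norm (A $$ (i, j)) * m)"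
    by (intro sum_norm_le) (auto simp: norm_mult intro!: mult_left_mono m_ge)
  also have "\<dots> = (\<Sum>j\<in>{..<n} - {i}. norm (A $$ (i, j))) * m"
    by (simp add: sum_distrib_right)
  finally show ?thesis
    using i m_pos by auto
qed

text \<open>The bound is the same number for all \<open>N\<close>, \<open>p\<close> and
  \<open>s\<close>, so it serves both halves of the theorem.\<close>

lemma voltage_submatrix_eigenvalue_Re_le:
  assumes params: "third_order_params N p" and shunt: "\<forall>i<N. shunt p i \<le> 0"
    and ev: "eigenvalue (map_mat complex_of_real (voltage_submatrix N p s)) z"
  shows "Re z \<le> -1"
proof -
  let ?C = "voltage_submatrix N p s"
  have dim: "map_mat complex_of_real ?C \<in> carrier_mat N N"
    by (simp add: voltage_submatrix_def)
  obtain i where i: "i < N"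
    and disc: "norm (z - map_mat complex_of_real ?C $$ (i, i))
      \<le> (\<Sum>j\<in>{..<N} - {i}. norm (map_mat complex_of_real ?C $$ (i, j)))"
    using gershgorin[OF dim ev] by blast
  have X: "reactance p i \<ge> 0"
    and B: "\<And>j. j < N \<Longrightarrow> j \<noteq> i \<Longrightarrow> suscept p i j \<ge> 0"
    using params i unfolding third_order_params_def by auto
  have "(\<Sum>j\<in>{..<N} - {i}. norm (map_mat complex_of_real ?C $$ (i, j)))
      \<le> (\<Sum>j\<in>{..<N} - {i}. reactance p i * suscept p i j)"
  proof (rule sum_mono)
    fix j assume "j \<in> {..<N} - {i}"
    then have j: "j < N" "j \<noteq> i" by auto
    have "norm (map_mat complex_of_real ?C $$ (i, j))
        = reactance p i * suscept p i j * \<bar>cos (angle s j - angle s i)\<bar>"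
      using i j X B[OF j] by (simp add: voltage_submatrix_def norm_mult)
    \<comment> \<open>The coupling is nonnegative, so the factor
      \<open>\<bar>cos\<bar> \<le> 1\<close> can only shrink it.\<close>
    also have "\<dots> \<le> reactance p i * suscept p i j"
      using X B[OF j] by (intro mult_right_le_one_le) auto
    finally show "norm (map_mat complex_of_real ?C $$ (i, j))
      \<le> reactance p i * suscept p i j" .
  qed
  \<comment> \<open>The disc has a real centre, so the left side is the real part of the difference
    on the right.\<close>
  moreover have "Re z - ?C $$ (i, i) \<le> norm (z - map_mat complex_of_real ?C $$ (i, i))"
    using complex_Re_le_cmod[of "z - map_mat complex_of_real ?C $$ (i, i)"] i
    by (simp add: voltage_submatrix_def)
  ultimately have "Re z \<le> ?C $$ (i, i) + reactance p i * (\<Sum>j\<in>{..<N} - {i}. suscept p i j)"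
    using disc by (simp add: sum_distrib_left)
  also have "\<dots> = reactance p i * shunt p i - 1"
    using i by (simp add: voltage_submatrix_def)
  also have "\<dots> \<le> -1"
    using X shunt i by (simp add: mult_nonneg_nonpos)
  finally show ?thesis .
qed

theorem mainTheorem1:
  shows "(\<forall>(N::nat) (p::machine_params) (s::machine_state).
            third_order_params N p \<and> (\<forall>i<N. shunt p i \<le> 0) \<and> equilibrium N p s \<longrightarrow>
            (\<forall>z::complex. eigenvalue (map_mat complex_of_real (voltage_submatrix N p s)) z \<longrightarrow>
               Re z < 0))
       \<and> (\<exists>\<delta>::real. \<delta> > 0 \<and>
            (\<forall>(N::nat) (p::machine_params) (s::machine_state).
               third_order_params N p \<and> (\<forall>i<N. shunt p i \<le> 0) \<and> equilibrium N p s \<longrightarrow>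
               (\<forall>z::complex. eigenvalue (map_mat complex_of_real (voltage_submatrix N p s)) z \<longrightarrow>
                  Re z \<le> - \<delta>)))"
\<comment> \<open>The witness 1 for \<delta> is the intrinsic decay rate of
  \<open>E\<^sub>i\<close>: the term -1 in the factor \<open>X\<^sub>i \<Gamma>\<^sub>i - 1\<close>
  of the voltage equation.\<close>
proof (intro conjI exI[of _ "1 :: real"] allI impI)
  fix N p s z
  assume "third_order_params N p \<and> (\<forall>i<N. shunt p i \<le> 0) \<and> equilibrium N p s"
    and "eigenvalue (map_mat complex_of_real (voltage_submatrix N p s)) z"
  then have *: "Re z \<le> -1"
    using voltage_submatrix_eigenvalue_Re_le by blast
  then show "Re z \<le> -1" .
  from * show "Re z < 0" by simp
qed simp

end
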